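(* Let $f$ be a locally univalent meromorphic function in $\mathbb{D}$ with $f(0)=0$ and let $0<\varrho<1$. Suppose that $f:(\mathbb{D},d_{\mathbb{D}})\to(\hat{\mathbb{C}},d_{\hat{\mathbb{C}}})$ is length-preserving on the circle $|z|=\varrho$. Then there is $\eta\in\mathbb{C}$ such that $f(z)=\eta z$ for all $z\in\mathbb{D}$.
   Context: $\mathbb{D}=\{z\in\mathbb{C}:|z|<1\}$ and $\hat{\mathbb{C}}=\mathbb{C}\cup\{\infty\}$ is the Riemann sphere. A meromorphic function $f$ in $\mathbb{D}$ is locally univalent if every point of $\mathbb{D}$ has a neighborhood on which $f$, viewed as a map into $\hat{\mathbb{C}}$, is injective. $d_{\mathbb{D}}$ is the hyperbolic distance on $\mathbb{D}$, induced by the metric $\frac{|dz|}{1-|z|^2}$, and $d_{\hat{\mathbb{C}}}$ is the spherical distance on $\hat{\mathbb{C}}$, induced by the metric $\frac{|dw|}{1+|w|^2}$. The map $f:(\mathbb{D},d_{\mathbb{D}})\to(\hat{\mathbb{C}},d_{\hat{\mathbb{C}}})$ is called length-preserving on the circle $|z|=\varrho<1$ if for each subarc $\gamma$ of $|z|=\varrho$ the spherical length of $f(\gamma)$ (i.e. of the image curve $f\circ\gamma$, $\int_\gamma \frac{|f'(z)|}{1+|f(z)|^2}\,|dz|$) is exactly the hyperbolic length $\int_\gamma\frac{|dz|}{1-|z|^2}$ of $\gamma$. *)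

theory Defs
  imports "HOL-Complex_Analysis.Complex_Analysis"
begin

datatype riemann_sphere = Finite complex | Infinity

text \<open>
  A meromorphic function on the disc is represented by its canonical representative in the
  sense of \<open>nicely_meromorphic_on\<close>: all removable singularities are removed, and the value
  at a pole is the dummy value \<open>0\<close>. The following is the actual map into the sphere.
\<close>
definition sphere_map :: "(complex \<Rightarrow> complex) \<Rightarrow> complex \<Rightarrow> riemann_sphere" where
  "sphere_map f z = (if is_pole f z then Infinity else Finite (f z))"

definition locally_univalent_on :: "(complex \<Rightarrow> complex) \<Rightarrow> complex set \<Rightarrow> bool" where
  "locally_univalent_on f A \<longleftrightarrow>
     (\<forall>z\<in>A. \<exists>U. open U \<and> z \<in> U \<and> U \<subseteq> A \<and> inj_on (sphere_map f) U)"

text \<open>Length of the path \<open>\<gamma>\<close> with respect to the conformal metric \<open>\<sigma>(z) |dz|\<close>.\<close>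
definition conformal_length :: "(complex \<Rightarrow> real) \<Rightarrow> (real \<Rightarrow> complex) \<Rightarrow> real" where
  "conformal_length \<sigma> \<gamma> =
     integral {0..1} (\<lambda>t. \<sigma> (\<gamma> t) * norm (vector_derivative \<gamma> (at t within {0..1})))"

definition hyperbolic_density :: "complex \<Rightarrow> real" where
  "hyperbolic_density z = 1 / (1 - (norm z)\<^sup>2)"

text \<open>
  The factor \<open>|f'| / (1 + |f|\<^sup>2)\<close> is invariant under replacing \<open>f\<close> by \<open>1/f\<close>. At a pole it is
  computed from \<open>1/f\<close>, which vanishes there; this is the continuous extension to the pole
  (note that \<open>f z = 0\<close> and \<open>inverse 0 = 0\<close>, so \<open>inverse \<circ> f\<close> is holomorphic near a pole).
\<close>
definition spherical_derivative :: "(complex \<Rightarrow> complex) \<Rightarrow> complex \<Rightarrow> real" where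
  "spherical_derivative f z =
     (if is_pole f z then norm (deriv (\<lambda>w. inverse (f w)) z)
      else norm (deriv f z) / (1 + (norm (f z))\<^sup>2))"

definition hyperbolic_length :: "(real \<Rightarrow> complex) \<Rightarrow> real" where
  "hyperbolic_length \<gamma> = conformal_length hyperbolic_density \<gamma>"

text \<open>Spherical length of the image curve \<open>f \<circ> \<gamma>\<close>.\<close>
definition spherical_image_length :: "(complex \<Rightarrow> complex) \<Rightarrow> (real \<Rightarrow> complex) \<Rightarrow> real" where
  "spherical_image_length f \<gamma> = conformal_length (spherical_derivative f) \<gamma>"

definition length_preserving_on_circle :: "(complex \<Rightarrow> complex) \<Rightarrow> real \<Rightarrow> bool" where
  "length_preserving_on_circle f \<rho> \<longleftrightarrow>
     (\<forall>a b. a < b \<and> b \<le> a + 2 * pi \<longrightarrow>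
        spherical_image_length f (part_circlepath 0 \<rho> a b) =
        hyperbolic_length (part_circlepath 0 \<rho> a b))"

end

theory Submission
  imports Defs
begin

text \<open>
  Let \<open>u\<close> be the logarithm of the spherical derivative of \<open>f\<close>. It satisfies Liouville's equation
  \<open>\<Delta>u = - 4 exp (2 u)\<close>, and length preservation says that \<open>u = - ln (1 - \<rho>\<^sup>2)\<close> on the circle \<open>\<bar>z\<bar> = \<rho>\<close>. One has to show that
  \<open>u\<close> is radially symmetric. The argument below is complex-analytic and exploits that half the Schwarzian derivative
  of \<open>f\<close>, called \<open>P\<close>, is holomorphic in the whole disc, since \<open>f\<close> is locally univalent.

  Poles are removed from the discussion by writing \<open>f = w1 / w2\<close> on a disc of radius \<open>R < 1\<close> with holomorphic
  functions of Wronskian one (\<open>spherical_lift\<close>). The spherical derivative of \<open>f\<close> is then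
  \<open>1 / (\<bar>w1\<bar>\<^sup>2 + \<bar>w2\<bar>\<^sup>2)\<close>, and both functions solve \<open>w'' = - P w\<close>. Constancy of \<open>\<bar>w1\<bar>\<^sup>2 + \<bar>w2\<bar>\<^sup>2 = C\<close> on the circle
  turns into the equation \<open>z\<^sup>2 P z = \<kappa> - (y t)\<^sup>2 - \<i> * y' t\<close> at \<open>z = \<rho> exp (\<i> t)\<close>, where \<open>y\<close> is real-valued and
  \<open>\<kappa> = 1 / 4 - \<rho>\<^sup>2 / C\<^sup>2 < 1 / 4\<close> (\<open>normalized_pair_rigidity\<close>).

  The key point is that such an equation forces \<open>P = 0\<close> (\<open>riccati_rigidity\<close>): a holomorphic function
  vanishing to second order at the origin satisfies a Wirtinger inequality which is incompatible with the equation unless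
  \<open>y\<close> is constant or \<open>\<bar>y\<bar>\<close> reaches \<open>1\<close>, and \<open>\<kappa> < 1 / 4\<close> rules out the latter. Once \<open>P = 0\<close>, the functions \<open>w1\<close> and \<open>w2\<close> are affine, \<open>f\<close> is a
  Moebius transformation with \<open>f 0 = 0\<close>, and constancy of \<open>\<bar>w1\<bar>\<^sup>2 + \<bar>w2\<bar>\<^sup>2\<close> on the circle makes it linear.
  Finally \<open>R\<close> is arbitrary, and the slope, being the derivative of \<open>f\<close> at \<open>0\<close>, does not depend on \<open>R\<close>.
\<close>

section \<open>Mean values on circles\<close>

lemma circle_mean_value:
  assumes "f holomorphic_on ball 0 R" and "0 < r" "r < R"
  shows "((\<lambda>t. f (of_real r * cis t)) has_integral (2 * of_real pi * f 0)) {0..2*pi}"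
proof -
  have "((\<lambda>u. f u / (u - 0)) has_contour_integral (2 * of_real pi * \<i> * f 0)) (circlepath 0 r)"
    using assms
    by (intro Cauchy_integral_circlepath_simple) (auto intro!: holomorphic_on_subset[OF assms(1)])
  then have "((\<lambda>t. f (of_real r * cis t) / (of_real r * cis t) * of_real r * \<i> * cis t)
      has_integral (2 * of_real pi * \<i> * f 0)) {0..2*pi}"
    unfolding circlepath_def by (subst (asm) has_contour_integral_part_circlepath_iff) auto
  then have "((\<lambda>t. \<i> * f (of_real r * cis t)) has_integral (\<i> * (2 * of_real pi * f 0))) {0..2*pi}"
    by (rule has_integral_eq_rhs[OF has_integral_eq, rotated]) (use assms in \<open>auto simp: field_simps\<close>)
  then have "((\<lambda>t. (-\<i>) * (\<i> * f (of_real r * cis t))) has_integral (-\<i>) * (\<i> * (2 * of_real pi * f 0))) {0..2*pi}"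
    by (rule has_integral_mult_right)
  then show ?thesis by (simp flip: mult.assoc)
qed

lemma monomials_orthogonal_on_circle:
  assumes "0 < r"
  shows "((\<lambda>t. (of_real r * cis t) ^ k * cnj ((of_real r * cis t) ^ n)) has_integral
     (if k = n then of_real (2 * pi * r ^ (2 * n)) else 0)) {0..2*pi}"
proof -
  have ge: "((\<lambda>t. (of_real r * cis t) ^ k * cnj ((of_real r * cis t) ^ n)) has_integral
     (if k = n then of_real (2 * pi * r ^ (2 * n)) else 0)) {0..2*pi}" if "n \<le> k" for k n
  proof -
    have "((\<lambda>t. (\<lambda>z. z ^ (k - n) * of_real (r ^ (2 * n))) (of_real r * cis t)) has_integral
      (2 * of_real pi * (\<lambda>z. z ^ (k - n) * of_real (r ^ (2 * n))) 0)) {0..2*pi}"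
      by (rule circle_mean_value[of _ "r + 1"]) (use assms in \<open>auto intro!: holomorphic_intros\<close>)
    moreover have "(of_real r * cis t) ^ (k - n) * of_real (r ^ (2 * n))
       = (of_real r * cis t) ^ k * cnj ((of_real r * cis t) ^ n)" for t
    proof -
      have "of_real (r ^ (2 * n)) = (of_real r * cis t) ^ n * cnj ((of_real r * cis t) ^ n)"
        by (simp add: power_mult_distrib power2_eq_square power_mult flip: cis_cnj)
           (simp add: cis_cnj cis_mult flip: power_mult_distrib)
      then show ?thesis
        using that by (simp flip: mult.assoc power_add)
    qed
    ultimately show ?thesis using that
      by (auto split: if_splits simp: power_0_left)
  qed
  show ?thesis
  proof (cases "n \<le> k")
    case False
    then have "((\<lambda>t. cnj ((of_real r * cis t) ^ n * cnj ((of_real r * cis t) ^ k))) has_integral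
       cnj (if n = k then of_real (2 * pi * r ^ (2 * k)) else 0)) {0..2*pi}"
      using has_integral_linear[OF ge[of k n] bounded_linear_cnj] by (simp only: o_def)
    then show ?thesis using False by (auto simp: mult.commute)
  qed (rule ge)
qed

text \<open>
  The partial sums of the power series converge uniformly on the circle, where the monomials are
  orthogonal.
\<close>
lemma parseval_on_circle:
  fixes f :: "complex \<Rightarrow> complex"
  assumes f: "\<And>z. norm z < R \<Longrightarrow> (\<lambda>n. c n * z ^ n) sums f z" and r: "0 < r" "r < R"
  shows "(\<lambda>n. (norm (c n))\<^sup>2 * r ^ (2 * n)) sums
           (1 / (2 * pi) * integral {0..2*pi} (\<lambda>t. (norm (f (of_real r * cis t)))\<^sup>2))"
proof -
  define z where "z = (\<lambda>t. of_real r * cis t)"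
  have nz: "norm (z t) = r" for t using r by (simp add: z_def norm_mult)
  have cz: "continuous_on X z" for X unfolding z_def by (intro continuous_intros)
  define S where "S = (\<lambda>N t. \<Sum>k<N. c k * z t ^ k)"
  obtain s where s: "r < s" "s < R" using r(2) dense by blast
  have "summable (\<lambda>n. norm (c n * of_real r ^ n))"
    by (rule powser_insidea[OF sums_summable[OF f], of "of_real s"]) (use s r in auto)
  then have sm: "summable (\<lambda>n. norm (c n) * r ^ n)" using r by (simp add: norm_mult norm_power)
  have "uniform_limit {0..2*pi} S (\<lambda>t. \<Sum>k. c k * z t ^ k) sequentially"
    unfolding S_def by (rule Weierstrass_m_test[OF _ sm]) (simp add: norm_mult norm_power nz)
  then have ul: "uniform_limit {0..2*pi} S (\<lambda>t. f (z t)) sequentially"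
    using sums_unique[OF f, of "z _"] r by (simp add: nz)
  have cS: "continuous_on {0..2*pi} (S N)" for N
    unfolding S_def by (intro continuous_intros cz)
  have cf: "continuous_on {0..2*pi} (\<lambda>t. f (z t))"
    by (rule uniform_limit_theorem[OF _ ul]) (auto simp: cS)
  have bd: "bounded ((\<lambda>t. f (z t)) ` {0..2*pi})"
    by (intro compact_imp_bounded compact_continuous_image cf) auto
  have bd': "bounded ((\<lambda>t. cnj (f (z t))) ` {0..2*pi})"
    by (intro compact_imp_bounded compact_continuous_image continuous_intros cf) auto
  have ul': "uniform_limit {0..2*pi} (\<lambda>N t. cnj (S N t)) (\<lambda>t. cnj (f (z t))) sequentially"
    by (rule bounded_linear.uniform_limit[OF bounded_linear_cnj ul]) 
  have ulp: "uniform_limit {0..2*pi} (\<lambda>N t. S N t * cnj (S N t)) (\<lambda>t. f (z t) * cnj (f (z t))) sequentially"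
    by (rule uniform_lim_mult[OF ul ul' bd bd'])
  obtain I J where I: "\<And>N. ((\<lambda>t. S N t * cnj (S N t)) has_integral I N) {0..2*pi}"
      and J: "((\<lambda>t. f (z t) * cnj (f (z t))) has_integral J) {0..2*pi}" and IJ: "I \<longlonglongrightarrow> J"
    by (rule uniform_limit_integral[OF ulp]) (auto intro!: continuous_intros cS)
  have "((\<lambda>t. S N t * cnj (S N t)) has_integral (of_real (2 * pi * (\<Sum>n<N. (norm (c n))\<^sup>2 * r ^ (2 * n))))) {0..2*pi}" for N
  proof -
    have "((\<lambda>t. \<Sum>n<N. \<Sum>k<N. c n * cnj (c k) * (z t ^ n * cnj (z t ^ k))) has_integral
      (\<Sum>n<N. \<Sum>k<N. c n * cnj (c k) * (if n = k then of_real (2 * pi * r ^ (2 * k)) else 0))) {0..2*pi}"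
      unfolding z_def
      by (intro has_integral_sum finite_lessThan has_integral_mult_right monomials_orthogonal_on_circle r)
    also have "(\<lambda>t. \<Sum>n<N. \<Sum>k<N. c n * cnj (c k) * (z t ^ n * cnj (z t ^ k))) = (\<lambda>t. S N t * cnj (S N t))"
      unfolding S_def by (auto simp: sum_product algebra_simps)
    also have "(\<Sum>n<N. \<Sum>k<N. c n * cnj (c k) * (if n = k then of_real (2 * pi * r ^ (2 * k)) else 0))
       = of_real (2 * pi * (\<Sum>n<N. (norm (c n))\<^sup>2 * r ^ (2 * n)))"
      by (simp add: if_distrib[of "(*) _"] sum_distrib_left complex_norm_square[symmetric] algebra_simps
          cong: if_cong)
    finally show ?thesis .
  qed
  then have Ieq: "I N = of_real (2 * pi * (\<Sum>n<N. (norm (c n))\<^sup>2 * r ^ (2 * n)))" for N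
    using I has_integral_unique by blast
  have "((\<lambda>t. Re (f (z t) * cnj (f (z t)))) has_integral Re J) {0..2*pi}"
    using has_integral_linear[OF J bounded_linear_Re] by (simp add: o_def)
  then have J': "integral {0..2*pi} (\<lambda>t. (norm (f (z t)))\<^sup>2) = Re J"
    by (auto simp: complex_norm_square[symmetric] cmod_power2 power2_eq_square intro!: integral_unique)
  have "(\<lambda>N. 1 / (2 * pi) * Re (I N)) \<longlonglongrightarrow> 1 / (2 * pi) * Re J"
    by (intro tendsto_intros IJ)
  then show ?thesis
    unfolding sums_def Ieq using J' by (simp add: z_def)
qed


text \<open>
  The mean of \<open>f\<^sup>2\<close> over the circle is \<open>(f 0)\<^sup>2 = 0\<close>, so its real part, the mean of
  \<open>(Re f)\<^sup>2 - (Im f)\<^sup>2\<close>, vanishes as well.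
\<close>
lemma circle_norm_square:
  assumes "f holomorphic_on ball 0 R" "0 < r" "r < R" "f 0 = 0"
  shows "integral {0..2*pi} (\<lambda>t. (norm (f (of_real r * cis t)))\<^sup>2)
           = 2 * integral {0..2*pi} (\<lambda>t. (Re (f (of_real r * cis t)))\<^sup>2)"
    and "integral {0..2*pi} (\<lambda>t. (norm (f (of_real r * cis t)))\<^sup>2)
           = 2 * integral {0..2*pi} (\<lambda>t. (Im (f (of_real r * cis t)))\<^sup>2)"
proof -
  define g where "g = (\<lambda>t. f (of_real r * cis t))"
  have cont: "continuous_on {0..2*pi} g"
    unfolding g_def
    by (rule continuous_on_compose2[OF holomorphic_on_imp_continuous_on[OF assms(1)]])
       (use assms in \<open>auto intro!: continuous_intros simp: dist_norm norm_mult\<close>)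
  have int: "(\<lambda>t. (Re (g t))\<^sup>2) integrable_on {0..2*pi}" "(\<lambda>t. (Im (g t))\<^sup>2) integrable_on {0..2*pi}"
    by (intro integrable_continuous_interval continuous_intros cont)+
  have "((\<lambda>t. (g t)\<^sup>2) has_integral (2 * of_real pi * (f 0)\<^sup>2)) {0..2*pi}"
    unfolding g_def by (rule circle_mean_value) (use assms in \<open>auto intro!: holomorphic_intros\<close>)
  from has_integral_linear[OF this bounded_linear_Re]
  have "((\<lambda>t. (Re (g t))\<^sup>2 - (Im (g t))\<^sup>2) has_integral 0) {0..2*pi}"
    by (simp only: o_def assms Re_power2) simp
  then have eq: "integral {0..2*pi} (\<lambda>t. (Re (g t))\<^sup>2) = integral {0..2*pi} (\<lambda>t. (Im (g t))\<^sup>2)"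
    using integral_diff[OF int] by (simp add: integral_unique[OF \<open>(_ has_integral 0) _\<close>])
  have "integral {0..2*pi} (\<lambda>t. (norm (g t))\<^sup>2)
      = integral {0..2*pi} (\<lambda>t. (Re (g t))\<^sup>2) + integral {0..2*pi} (\<lambda>t. (Im (g t))\<^sup>2)"
    unfolding cmod_power2 by (rule integral_add[OF int])
  with eq show "integral {0..2*pi} (\<lambda>t. (norm (f (of_real r * cis t)))\<^sup>2)
           = 2 * integral {0..2*pi} (\<lambda>t. (Re (f (of_real r * cis t)))\<^sup>2)"
    and "integral {0..2*pi} (\<lambda>t. (norm (f (of_real r * cis t)))\<^sup>2)
           = 2 * integral {0..2*pi} (\<lambda>t. (Im (f (of_real r * cis t)))\<^sup>2)"
    by (simp_all add: g_def)
qed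

lemma power_series_euler_operator:
  fixes f :: "complex \<Rightarrow> complex"
  assumes "\<And>z. norm z < R \<Longrightarrow> (\<lambda>n. d n * z ^ n) sums f z"
    and "(f has_field_derivative f') (at z)" "norm z < R"
  shows "(\<lambda>n. (of_nat n * d n) * z ^ n) sums (z * f')"
proof -
  have "(\<lambda>n. diffs d n * z ^ n) sums f'"
    by (rule termdiffs_sums_strong[OF assms])
  then have "(\<lambda>n. z * (diffs d n * z ^ n)) sums (z * f')"
    by (rule sums_mult)
  then have "(\<lambda>n. (of_nat (Suc n) * d (Suc n)) * z ^ Suc n) sums (z * f')"
    by (simp add: diffs_def mult_ac)
  then show ?thesis
    by (subst (asm) sums_Suc_iff) simp
qed

text \<open>
  The sum is dominated by a telescoping one, as \<open>1 / n\<^sup>2 < 1 / (n\<^sup>2 - 1 / 4)\<close>. The exact value of the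
  infinite sum would be \<open>\<pi>\<^sup>2 / 6 - 1\<close>, but the rational bound \<open>2 / 3\<close> is just good enough for
  \<open>sup_below_one\<close>.
\<close>
lemma sum_inverse_squares_from_two:
  "(\<Sum>n<N. (if n < 2 then 0 else 1 / real n)\<^sup>2) \<le> 2 / 3"
proof -
  have "(\<Sum>n<N + 2. (if n < 2 then 0 else 1 / real n)\<^sup>2) \<le> 2 / 3 - 1 / (real N + 3 / 2)" for N
  proof (induction N)
    case (Suc N)
    have "1 / (real N + 2)\<^sup>2 \<le> 1 / ((real N + 2)\<^sup>2 - 1 / 4)"
      by (intro divide_left_mono) (auto simp: power2_eq_square algebra_simps intro!: mult_pos_pos add_pos_nonneg)
    also have "\<dots> = 1 / (real N + 3 / 2) - 1 / (real N + 5 / 2)"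
    proof -
      have "(real N + 2)\<^sup>2 - 1 / 4 = (real N + 3 / 2) * (real N + 5 / 2)"
        by (simp add: power2_eq_square algebra_simps)
      then show ?thesis unfolding \<open>(real N + 2)\<^sup>2 - 1 / 4 = _\<close>
        by (subst diff_frac_eq) auto
    qed
    finally show ?case using Suc by (simp add: power_divide add.commute)
  qed (simp add: numeral_2_eq_2)
  from this[of N] have "(\<Sum>n<N + 2. (if n < 2 then 0 else 1 / real n)\<^sup>2) \<le> 2 / 3"
    by (rule order_trans) simp
  moreover have "(\<Sum>n<N. (if n < 2 then 0 else 1 / real n)\<^sup>2) \<le> (\<Sum>n<N + 2. (if n < 2 then 0 else 1 / real n)\<^sup>2)"
    by (intro sum_mono2) auto
  ultimately show ?thesis by linarith
qed

text \<open>
  Cauchy--Schwarz applied to \<open>d n * z ^ n = (1 / n) * (n * d n * z ^ n)\<close>: the sup norm of a function is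
  controlled by the mean square of its Euler derivative \<open>z f'\<close>. The term for \<open>n = 1\<close>
  would raise the constant by one, which is more than \<open>sup_below_one\<close> can afford.
\<close>
lemma power_series_deviation_bound:
  fixes F z :: complex
  assumes F: "(\<lambda>n. d n * z ^ n) sums F" and "d 1 = 0"
    and b: "(\<lambda>n. (norm (of_nat n * d n))\<^sup>2 * norm z ^ (2 * n)) sums b"
  shows "(norm (F - d 0))\<^sup>2 \<le> 2 / 3 * b"
proof -
  have "(\<lambda>N. (norm ((\<Sum>n<N. d n * z ^ n) - d 0))\<^sup>2) \<longlonglongrightarrow> (norm (F - d 0))\<^sup>2"
    using F unfolding sums_def by (intro tendsto_intros)
  moreover have "(norm ((\<Sum>n<N. d n * z ^ n) - d 0))\<^sup>2 \<le> 2 / 3 * b" if "N \<ge> 1" for N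
  proof -
    let ?a = "\<lambda>n. if n < 2 then 0 else 1 / real n"
    let ?b = "\<lambda>n. norm (of_nat n * d n) * norm z ^ n"
    have "(\<Sum>n<N. d n * z ^ n) - d 0 = (\<Sum>n\<in>{..<N} - {0}. d n * z ^ n)"
      using that by (subst sum.remove[of "{..<N}" 0]) auto
    also have "norm \<dots> \<le> (\<Sum>n\<in>{..<N} - {0}. ?a n * ?b n)"
    proof (rule sum_norm_le)
      fix n assume n: "n \<in> {..<N} - {0}"
      show "norm (d n * z ^ n) \<le> ?a n * ?b n"
      proof (cases "n < 2")
        case True
        with n have "n = 1" by auto
        with assms(2) show ?thesis by simp
      qed (use n in \<open>simp add: norm_mult norm_power\<close>)
    qed
    also have "\<dots> = (\<Sum>n<N. ?a n * ?b n)"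
      by (rule sum.mono_neutral_left) auto
    finally have "(norm ((\<Sum>n<N. d n * z ^ n) - d 0))\<^sup>2 \<le> (\<Sum>n<N. ?a n * ?b n)\<^sup>2"
      by (intro power_mono) auto
    also have "\<dots> \<le> (\<Sum>n<N. (?a n)\<^sup>2) * (\<Sum>n<N. (?b n)\<^sup>2)"
      by (rule Cauchy_Schwarz_ineq_sum)
    also have "\<dots> \<le> 2 / 3 * b"
    proof (intro mult_mono sum_inverse_squares_from_two sum_nonneg)
      show "(\<Sum>n<N. (?b n)\<^sup>2) \<le> b"
        using sum_le_suminf[OF sums_summable[OF b], of "{..<N}"] sums_unique[OF b]
        by (simp add: power_mult_distrib mult.commute flip: power_mult)
    qed auto
    finally show ?thesis .
  qed
  ultimately show ?thesis
    by (intro LIMSEQ_le_const2) auto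
qed


section \<open>Rigidity of a Riccati equation with holomorphic right-hand side\<close>

text \<open>
  Here \<open>M\<close> is the maximum of \<open>\<bar>y\<bar>\<close> for the function \<open>y\<close> of the next lemma, \<open>v\<close> the value of \<open>y\<close> at a point
  where it is attained, \<open>b\<close> the mean of \<open>y\<close> and \<open>s\<^sup>2\<close> the mean of \<open>y\<^sup>2\<close>. Cancelling the factor \<open>M - s\<close> in
  \<open>(M - s)\<^sup>2 \<le> (4 / 3) s\<^sup>2 (M\<^sup>2 - s\<^sup>2)\<close> and using \<open>s\<^sup>2 \<le> 1 / 4\<close> leaves \<open>M \<le> 2 s\<close>.
\<close>
lemma sup_below_one:
  fixes M b s m :: real
  assumes "0 \<le> s" "s < 1 / 2" "\<bar>b\<bar> \<le> s" "\<bar>v\<bar> = M"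
    and "(v - b)\<^sup>2 \<le> 2 / 3 * m" "m \<le> 2 * (M\<^sup>2 * s\<^sup>2 - s\<^sup>2 * s\<^sup>2)"
  shows "M < 1"
proof (rule ccontr)
  assume "\<not> M < 1"
  then have pos: "M - s > 0" using assms by linarith
  have "(M - s)\<^sup>2 \<le> \<bar>v - b\<bar>\<^sup>2"
    using assms pos by (intro power_mono) linarith+
  also have "\<dots> \<le> 4 / 3 * s\<^sup>2 * (M\<^sup>2 - s\<^sup>2)"
    using assms(5,6) by (simp add: algebra_simps)
  also have "\<dots> = (M - s) * (4 / 3 * s\<^sup>2 * (M + s))"
    by (simp add: power2_eq_square algebra_simps)
  finally have "M - s \<le> 4 / 3 * s\<^sup>2 * (M + s)"
    using pos by (simp add: power2_eq_square)
  also have "\<dots> \<le> 1 / 3 * (M + s)"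
  proof (rule mult_right_mono)
    have "s\<^sup>2 \<le> (1 / 2)\<^sup>2" using assms by (intro power_mono) auto
    then show "4 / 3 * s\<^sup>2 \<le> 1 / 3" by (simp add: power2_eq_square)
  qed (use pos assms in linarith)
  finally show False using \<open>\<not> M < 1\<close> assms(2) by (simp add: field_simps)
qed

text \<open>
  Put \<open>q z = z\<^sup>2 P z\<close>, so that \<open>q = \<kappa> - y\<^sup>2 - \<i> y'\<close> on the circle. The functions \<open>q\<close>, \<open>q\<^sup>2\<close> and \<open>(z q')\<^sup>2\<close> vanish
  at the origin, hence have mean zero on the circle. This gives, for the mean values,

  \<^item> \<open>mean y\<^sup>2 = \<kappa>\<close>,
  \<^item> \<open>mean \<bar>q\<bar>\<^sup>2 = 2 mean (\<kappa> - y\<^sup>2)\<^sup>2 = 2 mean y'\<^sup>2\<close>,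
  \<^item> \<open>mean \<bar>z q'\<bar>\<^sup>2 = 2 mean (Im (z q'))\<^sup>2 = 8 mean (y\<^sup>2 y'\<^sup>2)\<close>, because differentiating \<open>Re q = \<kappa> - y\<^sup>2\<close> along the
    circle yields \<open>Im (z q') = 2 y y'\<close>.

  As \<open>q\<close> vanishes to second order at the origin, \<open>4 mean \<bar>q\<bar>\<^sup>2 \<le> mean \<bar>z q'\<bar>\<^sup>2\<close>, that is
  \<open>mean y'\<^sup>2 \<le> mean (y\<^sup>2 y'\<^sup>2)\<close>. If \<open>\<bar>y\<bar> < 1\<close> everywhere, this is only possible if \<open>y' = 0\<close>, and then
  \<open>mean \<bar>q\<bar>\<^sup>2 = 0\<close>. To see that \<open>\<bar>y\<bar> < 1\<close>, let \<open>F' z = z P z\<close>. Then \<open>z F' = q\<close>, and \<open>y\<close> equals the real part of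
  \<open>F\<close> up to a constant. Hence \<open>power_series_deviation_bound\<close> bounds the square of the distance of \<open>y\<close> from its mean
  by \<open>2 / 3\<close> times \<open>mean \<bar>q\<bar>\<^sup>2 = 2 mean (\<kappa> - y\<^sup>2)\<^sup>2\<close>, which in turn is bounded in terms of the maximum of \<open>\<bar>y\<bar>\<close>; the hypothesis
  \<open>\<kappa> < 1 / 4\<close> closes this loop in \<open>sup_below_one\<close>.
\<close>
lemma riccati_rigidity:
  fixes P :: "complex \<Rightarrow> complex" and y y' :: "real \<Rightarrow> real"
  assumes P: "P holomorphic_on ball 0 R" and r: "0 < r" "r < R"
    and \<kappa>: "\<kappa> < 1 / 4"
    and y: "\<And>t. (y has_real_derivative y' t) (at t)"
    and eq: "\<And>t. (of_real r * cis t)\<^sup>2 * P (of_real r * cis t) = of_real (\<kappa> - (y t)\<^sup>2) - \<i> * of_real (y' t)"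
    and z: "norm z < R"
  shows "P z = 0"
proof -
  define Z where "Z = (\<lambda>t. of_real r * cis t)"
  define q where "q = (\<lambda>z. z\<^sup>2 * P z)"
  have Z: "norm (Z t) = r" "Z t \<in> ball 0 R" for t using r by (auto simp: Z_def norm_mult)
  have dZ: "(Z has_vector_derivative (\<i> * Z t)) (at t)" for t
    unfolding Z_def cis_conv_exp
    by (auto intro!: derivative_eq_intros has_vector_derivative_real_field simp: has_real_derivative_iff_has_vector_derivative)
  have q: "q holomorphic_on ball 0 R" unfolding q_def by (intro holomorphic_intros P)
  have Req: "Re (q (Z t)) = \<kappa> - (y t)\<^sup>2" and Imq: "Im (q (Z t)) = - y' t" for t
    using eq[of t] by (simp_all add: q_def Z_def)
  have cy: "continuous_on X y" for X
    by (meson y DERIV_isCont continuous_at_imp_continuous_on)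
  have cqZ: "continuous_on X (\<lambda>t. q (Z t))" for X
    by (rule continuous_on_compose2[OF holomorphic_on_imp_continuous_on[OF q]])
       (use Z in \<open>auto simp: Z_def intro!: continuous_intros\<close>)
  have cy': "continuous_on X y'" for X
  proof -
    have "continuous_on X (\<lambda>t. - Im (q (Z t)))" by (intro continuous_intros cqZ)
    then show ?thesis by (simp add: Imq)
  qed
  have q0: "q 0 = 0" by (simp add: q_def)
  have fold_Z: "of_real r * cis t = Z t" for t by (simp add: Z_def)
  define I :: "(real \<Rightarrow> real) \<Rightarrow> real" where "I = integral {0..2*pi}"
  have int: "f integrable_on {0..2*pi}" if "continuous_on {0..2*pi} f" for f :: "real \<Rightarrow> real"
    using that by (rule integrable_continuous_interval)

  have Iy2: "I (\<lambda>t. (y t)\<^sup>2) = 2 * pi * \<kappa>"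
  proof -
    have "((\<lambda>t. q (Z t)) has_integral 0) {0..2*pi}"
      using circle_mean_value[OF q r] by (simp add: Z_def q_def)
    from has_integral_linear[OF this bounded_linear_Re]
    have "((\<lambda>t. \<kappa> - (y t)\<^sup>2) has_integral 0) {0..2*pi}" by (simp add: o_def Req)
    then have "integral {0..2*pi} (\<lambda>t. \<kappa> - (y t)\<^sup>2) = 0" by (rule integral_unique)
    moreover have "integral {0..2*pi} (\<lambda>t. \<kappa> - (y t)\<^sup>2) = 2 * pi * \<kappa> - I (\<lambda>t. (y t)\<^sup>2)"
      unfolding I_def by (subst integral_diff) (auto intro!: int continuous_intros cy)
    ultimately show ?thesis by simp
  qed
  have q_norm: "I (\<lambda>t. (norm (q (Z t)))\<^sup>2) = 2 * I (\<lambda>t. (\<kappa> - (y t)\<^sup>2)\<^sup>2)"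
               "I (\<lambda>t. (norm (q (Z t)))\<^sup>2) = 2 * I (\<lambda>t. (y' t)\<^sup>2)"
    using circle_norm_square[OF q r q0] by (simp_all add: I_def Req Imq fold_Z)

  define q' where "q' = (\<lambda>z. z * deriv q z)"
  have q': "q' holomorphic_on ball 0 R"
    unfolding q'_def by (intro holomorphic_intros holomorphic_deriv q) auto
  have dq: "(q has_field_derivative deriv q z) (at z)" if "norm z < R" for z
    using q that by (intro holomorphic_derivI[of q "ball 0 R"]) auto
  have Imq': "Im (q' (Z t)) = 2 * y t * y' t" for t
  proof -
    have "((q \<circ> Z) has_vector_derivative (\<i> * Z t * deriv q (Z t))) (at t)"
      by (rule field_vector_diff_chain_at[OF dZ dq]) (use Z r in simp)
    then have "((\<lambda>t. Re (q (Z t))) has_vector_derivative Re (\<i> * Z t * deriv q (Z t))) (at t)"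
      using bounded_linear.has_vector_derivative[OF bounded_linear_Re] unfolding o_def by blast
    then have "((\<lambda>t. \<kappa> - (y t)\<^sup>2) has_real_derivative (- Im (q' (Z t)))) (at t)"
      by (simp add: Req q'_def has_real_derivative_iff_has_vector_derivative algebra_simps)
    moreover have "((\<lambda>t. \<kappa> - (y t)\<^sup>2) has_real_derivative (- (2 * y t * y' t))) (at t)"
      by (auto intro!: derivative_eq_intros y)
    ultimately show ?thesis using DERIV_unique by fastforce
  qed
  have q'_norm: "I (\<lambda>t. (norm (q' (Z t)))\<^sup>2) = 8 * I (\<lambda>t. (y t)\<^sup>2 * (y' t)\<^sup>2)"
  proof -
    have "q' 0 = 0" by (simp add: q'_def)
    from circle_norm_square(2)[OF q' r this]
    have "I (\<lambda>t. (norm (q' (Z t)))\<^sup>2) = 2 * I (\<lambda>t. 4 * ((y t)\<^sup>2 * (y' t)\<^sup>2))"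
      by (simp add: I_def Imq' fold_Z power_mult_distrib mult.assoc)
    then show ?thesis by (simp add: I_def)
  qed

  obtain F where F: "\<And>z. norm z < R \<Longrightarrow> (F has_field_derivative z * P z) (at z)"
  proof -
    have "(\<lambda>z. z * P z) holomorphic_on ball 0 R" by (intro holomorphic_intros P)
    then obtain F where "\<And>z. z \<in> ball 0 R \<Longrightarrow> (F has_field_derivative z * P z) (at z within ball 0 R)"
      using holomorphic_convex_primitive'[OF convex_ball open_ball] by blast
    then show ?thesis
      by (intro that[of F]) (metis at_within_open mem_ball_0 open_ball)
  qed
  define d where "d = (\<lambda>n. (deriv ^^ n) F 0 / fact n)"
  have "F holomorphic_on ball 0 R"
    unfolding holomorphic_on_open[OF open_ball] using F mem_ball_0 by blast
  then have sF: "(\<lambda>n. d n * z ^ n) sums F z" if "norm z < R" for z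
    using holomorphic_power_series[of F 0 R z] that by (simp add: d_def)
  have sq: "(\<lambda>n. (of_nat n * d n) * z ^ n) sums q z" if "norm z < R" for z
    using power_series_euler_operator[OF sF F] that by (simp add: q_def power2_eq_square mult.assoc)
  have sq': "(\<lambda>n. (of_nat n * (of_nat n * d n)) * z ^ n) sums q' z" if "norm z < R" for z
    using power_series_euler_operator[OF sq dq] that by (simp add: q'_def)
  have d1: "d 1 = 0"
    using DERIV_imp_deriv[OF F[of 0]] r by (simp add: d_def)
  have d0: "d 0 = F 0" by (simp add: d_def)
  have Pq: "(\<lambda>n. (norm (of_nat n * d n))\<^sup>2 * r ^ (2 * n)) sums (1 / (2 * pi) * I (\<lambda>t. (norm (q (Z t)))\<^sup>2))"
    unfolding I_def Z_def by (rule parseval_on_circle[OF sq r])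
  have Pq': "(\<lambda>n. (norm (of_nat n * (of_nat n * d n)))\<^sup>2 * r ^ (2 * n)) sums (1 / (2 * pi) * I (\<lambda>t. (norm (q' (Z t)))\<^sup>2))"
    unfolding I_def Z_def by (rule parseval_on_circle[OF sq' r])

  \<comment> \<open>The coefficients of \<open>q\<close> start at index \<open>2\<close>, and \<open>4 \<le> n\<^sup>2\<close> from there on.\<close>
  have "4 * (1 / (2 * pi) * I (\<lambda>t. (norm (q (Z t)))\<^sup>2)) \<le> 1 / (2 * pi) * I (\<lambda>t. (norm (q' (Z t)))\<^sup>2)"
  proof (rule sums_le[OF _ sums_mult[OF Pq] Pq'])
    fix n
    show "4 * ((norm (of_nat n * d n))\<^sup>2 * r ^ (2 * n)) \<le> (norm (of_nat n * (of_nat n * d n)))\<^sup>2 * r ^ (2 * n)"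
    proof (cases "n < 2")
      case True
      then have "n = 0 \<or> n = 1" by auto
      with d1 show ?thesis by auto
    next
      case False
      then have "2\<^sup>2 \<le> (real n)\<^sup>2" by (intro power_mono) auto
      then have "4 * ((norm (of_nat n * d n))\<^sup>2 * r ^ (2 * n)) \<le> (real n)\<^sup>2 * ((norm (of_nat n * d n))\<^sup>2 * r ^ (2 * n))"
        using r by (intro mult_right_mono) auto
      then show ?thesis by (simp add: norm_mult power_mult_distrib mult.assoc)
    qed
  qed
  then have wirtinger: "I (\<lambda>t. (y' t)\<^sup>2) \<le> I (\<lambda>t. (y t)\<^sup>2 * (y' t)\<^sup>2)"
    unfolding q'_norm q_norm(2) by (simp add: field_simps)

  \<comment> \<open>Along the circle, \<open>F\<close> has derivative \<open>\<i> q\<close>, whose real part is \<open>y'\<close>.\<close>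
  have "\<exists>e. \<forall>t\<in>UNIV. y t - Re (F (Z t)) = e"
  proof (rule has_vector_derivative_zero_constant)
    fix t
    have "((F \<circ> Z) has_vector_derivative (\<i> * Z t * (Z t * P (Z t)))) (at t)"
      by (rule field_vector_diff_chain_at[OF dZ F]) (use Z r in simp)
    then have "((\<lambda>t. Re (F (Z t))) has_vector_derivative Re (\<i> * Z t * (Z t * P (Z t)))) (at t)"
      using bounded_linear.has_vector_derivative[OF bounded_linear_Re] unfolding o_def by blast
    also have "Re (\<i> * Z t * (Z t * P (Z t))) = y' t"
      using Imq[of t] by (simp add: q_def power2_eq_square algebra_simps)
    finally have "((\<lambda>t. y t - Re (F (Z t))) has_vector_derivative (y' t - y' t)) (at t)"
      using y[of t] by (intro has_vector_derivative_diff) (auto simp: has_real_derivative_iff_has_vector_derivative)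
    then show "((\<lambda>t. y t - Re (F (Z t))) has_vector_derivative 0) (at t within UNIV)" by simp
  qed auto
  then obtain e where e: "\<And>t. y t = e + Re (F (Z t))" by (metis UNIV_I diff_add_cancel)
  define b where "b = e + Re (d 0)"
  have Iy: "I y = 2 * pi * b"
  proof -
    have "((\<lambda>t. F (Z t)) has_integral 2 * of_real pi * F 0) {0..2*pi}"
      using circle_mean_value[OF \<open>F holomorphic_on ball 0 R\<close> r] by (simp add: Z_def)
    from has_integral_add[OF has_integral_const_real[of e 0 "2*pi"] has_integral_linear[OF this bounded_linear_Re]]
    have "(y has_integral (2 * pi * b)) {0..2*pi}"
      by (simp add: o_def e[symmetric] b_def d0 algebra_simps)
    then show ?thesis unfolding I_def by (rule integral_unique)
  qed
  \<comment> \<open>The square of the mean is at most the mean of the square.\<close>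
  have "b\<^sup>2 \<le> \<kappa>"
  proof -
    have "0 \<le> I (\<lambda>t. (y t - b)\<^sup>2)" unfolding I_def
      by (intro integral_nonneg int continuous_intros cy) auto
    also have "\<dots> = I (\<lambda>t. ((y t)\<^sup>2 - 2 * b * y t) + b\<^sup>2)"
      by (simp add: power2_eq_square algebra_simps)
    also have "\<dots> = I (\<lambda>t. (y t)\<^sup>2) - 2 * b * I y + 2 * pi * b\<^sup>2"
      unfolding I_def
      by (subst integral_add; (subst integral_diff)?) (auto intro!: int continuous_intros cy)
    finally have "0 \<le> 2 * pi * (\<kappa> - b\<^sup>2)"
      unfolding Iy Iy2 by (simp add: power2_eq_square algebra_simps)
    then show ?thesis using pi_gt_zero by (auto simp: zero_le_mult_iff)
  qed
  then have "0 \<le> \<kappa>" by (meson order_trans zero_le_power2)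
  define s where "s = sqrt \<kappa>"
  have s: "0 \<le> s" "s < 1 / 2" "s\<^sup>2 = \<kappa>" "\<bar>b\<bar> \<le> s"
    using \<open>0 \<le> \<kappa>\<close> \<kappa> \<open>b\<^sup>2 \<le> \<kappa>\<close> real_sqrt_less_mono[OF \<kappa>]
    by (auto simp: s_def real_sqrt_divide real_le_rsqrt intro: real_le_rsqrt)

  obtain t0 where t0: "t0 \<in> {0..2*pi}" "\<And>t. t \<in> {0..2*pi} \<Longrightarrow> \<bar>y t\<bar> \<le> \<bar>y t0\<bar>"
  proof -
    have "continuous_on {0..2*pi} (\<lambda>t. \<bar>y t\<bar>)" by (intro continuous_intros cy)
    from continuous_attains_sup[OF _ _ this] show ?thesis using that by force
  qed
  have "\<bar>y t0\<bar> < 1"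
  proof (rule sup_below_one[OF s(1,2,4) refl])
    have "(y t0 - b)\<^sup>2 = (Re (F (Z t0) - d 0))\<^sup>2" by (simp add: e b_def)
    also have "\<dots> \<le> (norm (F (Z t0) - d 0))\<^sup>2"
      by (simp add: cmod_power2)
    also have "\<dots> \<le> 2 / 3 * (1 / (2 * pi) * I (\<lambda>t. (norm (q (Z t)))\<^sup>2))"
      by (rule power_series_deviation_bound[of d "Z t0"]) (use sF Pq d1 Z r in simp_all)
    finally show "(y t0 - b)\<^sup>2 \<le> 2 / 3 * (1 / (2 * pi) * I (\<lambda>t. (norm (q (Z t)))\<^sup>2))" .
  next
    \<comment> \<open>This is \<open>y\<^sup>4 \<le> M\<^sup>2 y\<^sup>2\<close>, integrated.\<close>
    have "I (\<lambda>t. (\<kappa> - (y t)\<^sup>2)\<^sup>2) \<le> I (\<lambda>t. \<kappa>\<^sup>2 + (\<bar>y t0\<bar>\<^sup>2 - 2 * \<kappa>) * (y t)\<^sup>2)"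
      unfolding I_def
    proof (intro integral_le int continuous_intros cy)
      fix t assume t: "t \<in> {0..2*pi}"
      have "(y t)\<^sup>2 * (y t)\<^sup>2 \<le> \<bar>y t0\<bar>\<^sup>2 * (y t)\<^sup>2"
        using power_mono[OF t0(2)[OF t], of 2] by (intro mult_right_mono) auto
      then show "(\<kappa> - (y t)\<^sup>2)\<^sup>2 \<le> \<kappa>\<^sup>2 + (\<bar>y t0\<bar>\<^sup>2 - 2 * \<kappa>) * (y t)\<^sup>2"
        by (simp add: power2_diff algebra_simps power2_eq_square)
    qed
    also have "\<dots> = 2 * pi * \<kappa>\<^sup>2 + (\<bar>y t0\<bar>\<^sup>2 - 2 * \<kappa>) * I (\<lambda>t. (y t)\<^sup>2)"
      unfolding I_def by (subst integral_add) (auto intro!: int continuous_intros cy)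
    also have "\<dots> = 2 * pi * (\<bar>y t0\<bar>\<^sup>2 * \<kappa> - \<kappa> * \<kappa>)"
      unfolding Iy2 by (simp add: algebra_simps power2_eq_square)
    finally show "1 / (2 * pi) * I (\<lambda>t. (norm (q (Z t)))\<^sup>2) \<le> 2 * (\<bar>y t0\<bar>\<^sup>2 * s\<^sup>2 - s\<^sup>2 * s\<^sup>2)"
      unfolding q_norm(1) s(3) by (simp add: field_simps)
  qed
  then have y1: "(y t)\<^sup>2 < 1" if "t \<in> {0..2*pi}" for t
    using t0(2)[OF that] by (simp add: abs_square_less_1)
  have "I (\<lambda>t. (1 - (y t)\<^sup>2) * (y' t)\<^sup>2) \<le> 0"
  proof -
    have "I (\<lambda>t. (1 - (y t)\<^sup>2) * (y' t)\<^sup>2) = I (\<lambda>t. (y' t)\<^sup>2) - I (\<lambda>t. (y t)\<^sup>2 * (y' t)\<^sup>2)"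
      unfolding I_def left_diff_distrib mult_1
      by (intro integral_diff int continuous_intros cy cy')
    then show ?thesis using wirtinger by simp
  qed
  moreover have nn: "0 \<le> (1 - (y t)\<^sup>2) * (y' t)\<^sup>2" if "t \<in> {0..2*pi}" for t
    using y1[OF that] by simp
  then have "0 \<le> I (\<lambda>t. (1 - (y t)\<^sup>2) * (y' t)\<^sup>2)"
    unfolding I_def by (intro integral_nonneg int continuous_intros cy cy')
  ultimately have "integral {0..2*pi} (\<lambda>t. (1 - (y t)\<^sup>2) * (y' t)\<^sup>2) = 0"
    by (simp add: I_def)
  then have "\<forall>t\<in>{0..2*pi}. (1 - (y t)\<^sup>2) * (y' t)\<^sup>2 = 0"
    by (subst (asm) integral_eq_0_iff) (auto intro!: continuous_intros cy cy' nn)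
  then have "y' t = 0" if "t \<in> {0..2*pi}" for t
    using y1[OF that] that by fastforce
  then have "I (\<lambda>t. (y' t)\<^sup>2) = I (\<lambda>t. 0)"
    unfolding I_def by (intro integral_cong) simp
  then have "I (\<lambda>t. (norm (q (Z t)))\<^sup>2) = 0"
    using q_norm(2) by (simp add: I_def)
  with Pq have "(\<lambda>n. (norm (of_nat n * d n))\<^sup>2 * r ^ (2 * n)) sums 0" by simp
  then have "\<forall>n. (norm (of_nat n * d n))\<^sup>2 * r ^ (2 * n) = 0"
    using r by (subst suminf_eq_zero_iff[OF sums_summable, symmetric]) (auto simp: sums_unique[symmetric])
  then have dn: "of_nat n * d n = 0" for n using r by auto
  have P0: "P w = 0" if "norm w < R" "w \<noteq> 0" for w
    using sums_unique2[OF sq[OF that(1)], of 0] dn that by (simp add: q_def)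
  show ?thesis
  proof (cases "z = 0")
    \<comment> \<open>The power series of \<open>q\<close> says nothing about \<open>P 0\<close>; continuity does.\<close>
    case True
    have "P \<midarrow>0\<rightarrow> P 0"
      using P r by (metis centre_in_ball continuous_on_eq_continuous_at holomorphic_on_imp_continuous_on
          isCont_def open_ball order.strict_trans)
    moreover have "eventually (\<lambda>w. P w = 0) (at 0)"
      using r P0 by (auto simp: eventually_at intro!: exI[of _ R])
    then have "P \<midarrow>0\<rightarrow> 0" by (simp add: tendsto_eventually)
    ultimately show ?thesis using True LIM_unique by blast
  qed (use P0 z in auto)
qed


section \<open>Pairs of holomorphic functions with Wronskian one\<close>

lemma lagrange_identity_complex:
  fixes a1 a2 b1 b2 :: complex
  shows "(cnj a1 * b1 + cnj a2 * b2) * cnj (cnj a1 * b1 + cnj a2 * b2)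
           + (b1 * a2 - a1 * b2) * cnj (b1 * a2 - a1 * b2)
         = (a1 * cnj a1 + a2 * cnj a2) * (b1 * cnj b1 + b2 * cnj b2)"
  by (simp add: algebra_simps)

lemma holomorphic_affine_if_second_deriv_zero:
  assumes "w holomorphic_on ball 0 R" and "\<And>z. norm z < R \<Longrightarrow> deriv (deriv w) z = 0" and "norm z < R"
  shows "w z = w 0 + deriv w 0 * z"
proof -
  have dw: "(w has_field_derivative deriv w x) (at x within ball 0 R)" if "x \<in> ball 0 R" for x
    using holomorphic_derivI[OF assms(1) open_ball that] has_field_derivative_at_within by blast
  have ddw: "(deriv w has_field_derivative 0) (at x within ball 0 R)" if "x \<in> ball 0 R" for x
    using holomorphic_derivI[OF holomorphic_deriv[OF assms(1) open_ball] open_ball that] assms(2)[of x] that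
      has_field_derivative_at_within by fastforce
  have R: "0 \<in> ball 0 R" "z \<in> ball 0 R" using assms(3) by (auto intro: le_less_trans[OF norm_ge_zero])
  have c: "deriv w x = deriv w 0" if "x \<in> ball 0 R" for x
    using has_field_derivative_zero_constant[OF convex_ball ddw] that R by metis
  have "((\<lambda>z. w z - deriv w 0 * z) has_field_derivative 0) (at x within ball 0 R)" if "x \<in> ball 0 R" for x
    using dw[OF that] c[OF that] by (auto intro!: derivative_eq_intros)
  then obtain k where "\<And>x. x \<in> ball 0 R \<Longrightarrow> w x - deriv w 0 * x = k"
    using has_field_derivative_zero_constant[OF convex_ball] by metis
  from this[OF R(1)] this[OF R(2)] show ?thesis by (simp add: algebra_simps)
qed

text \<open>
  Comparing the hypothesis at \<open>z\<close> and \<open>- z\<close> shows that the real part of \<open>\<beta> * cnj (\<gamma> * z)\<close> vanishes, and \<open>z\<close> may be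
  both real and imaginary.
\<close>
lemma constant_norm_on_circle_imp_no_slope:
  fixes \<alpha> \<beta> \<gamma> :: complex
  assumes "\<And>z. norm z = r \<Longrightarrow> (norm (\<alpha> * z))\<^sup>2 + (norm (\<beta> + \<gamma> * z))\<^sup>2 = C" and "0 < r" "\<beta> \<noteq> 0"
  shows "\<gamma> = 0"
proof -
  have expand: "(norm (\<beta> + \<gamma> * z))\<^sup>2 = (norm \<beta>)\<^sup>2 + 2 * Re (\<beta> * cnj (\<gamma> * z)) + (norm (\<gamma> * z))\<^sup>2" for z
    unfolding cmod_power2 by (simp add: power2_eq_square algebra_simps)
  have zero: "Re (\<beta> * cnj (\<gamma> * z)) = 0" if "norm z = r" for z
    using assms(1)[OF that] assms(1)[of "- z"] that unfolding expand by simp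
  have "Re (\<beta> * cnj \<gamma>) * r = Re (\<beta> * cnj (\<gamma> * of_real r))"
    and "Im (\<beta> * cnj \<gamma>) * r = Re (\<beta> * cnj (\<gamma> * (\<i> * of_real r)))"
    by (simp_all add: algebra_simps)
  then have "Re (\<beta> * cnj \<gamma>) = 0" "Im (\<beta> * cnj \<gamma>) = 0"
    using zero[of "of_real r"] zero[of "\<i> * of_real r"] \<open>0 < r\<close> by (simp_all add: norm_mult)
  then have "\<beta> * cnj \<gamma> = 0" by (simp only: complex_eq_iff zero_complex.simps)
  then show ?thesis using \<open>\<beta> \<noteq> 0\<close> by simp
qed

text \<open>
  By the Wronskian condition both functions solve \<open>w'' = - P w\<close> for the same holomorphic \<open>P\<close>, half the
  Schwarzian derivative of \<open>w1 / w2\<close>. Let \<open>u = - ln (\<bar>w1\<bar>\<^sup>2 + \<bar>w2\<bar>\<^sup>2)\<close> be the logarithmic density of the pulled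
  back spherical metric. On the circle, where \<open>u\<close> is constant, \<open>z u\<^sub>z = - A / C\<close> with
  \<open>A = cnj w1 * z w1' + cnj w2 * z w2'\<close>. Differentiating \<open>\<bar>w1\<bar>\<^sup>2 + \<bar>w2\<bar>\<^sup>2 = C\<close> along the circle shows that
  \<open>A\<close> is real. Differentiating \<open>A\<close> and eliminating \<open>E = \<bar>z w1'\<bar>\<^sup>2 + \<bar>z w2'\<bar>\<^sup>2\<close> by means of
  Lagrange's identity \<open>\<bar>A\<bar>\<^sup>2 + \<bar>z\<bar>\<^sup>2 = C E\<close> gives
  \<open>z\<^sup>2 P = 1 / 4 - r\<^sup>2 / C\<^sup>2 - y\<^sup>2 - \<i> y'\<close> for \<open>y = 1 / 2 - A / C\<close>. (Geometrically, \<open>2 y\<close> is the geodesic curvature of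
  the image curve per unit of angle.) So \<open>riccati_rigidity\<close> applies and yields \<open>P = 0\<close>: both functions are
  affine.
\<close>
lemma normalized_pair_rigidity:
  fixes w1 w2 :: "complex \<Rightarrow> complex"
  assumes w: "w1 holomorphic_on ball 0 R" "w2 holomorphic_on ball 0 R" and r: "0 < r" "r < R"
    and wronskian: "\<And>z. norm z < R \<Longrightarrow> deriv w1 z * w2 z - w1 z * deriv w2 z = 1"
    and circle: "\<And>z. norm z = r \<Longrightarrow> (norm (w1 z))\<^sup>2 + (norm (w2 z))\<^sup>2 = C"
    and "w1 0 = 0" and z: "norm z < R"
  shows "w1 z = deriv w1 0 * z" "w2 z = w2 0"
proof -
  define P where "P = (\<lambda>z. deriv (deriv w1) z * deriv w2 z - deriv w1 z * deriv (deriv w2) z)"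
  have dhol: "deriv w1 holomorphic_on ball 0 R" "deriv w2 holomorphic_on ball 0 R"
    by (intro holomorphic_deriv w open_ball)+
  have P: "P holomorphic_on ball 0 R"
    unfolding P_def by (intro holomorphic_intros holomorphic_deriv w open_ball)
  have d1: "(w1 has_field_derivative deriv w1 z) (at z)" "(w2 has_field_derivative deriv w2 z) (at z)"
   and d2: "(deriv w1 has_field_derivative deriv (deriv w1) z) (at z)"
           "(deriv w2 has_field_derivative deriv (deriv w2) z) (at z)" if "norm z < R" for z
    using that w dhol by (auto intro!: holomorphic_derivI[of _ "ball 0 R"])
  have wr': "deriv (deriv w1) z * w2 z = w1 z * deriv (deriv w2) z" if "norm z < R" for z
  proof -
    have "((\<lambda>z. deriv w1 z * w2 z - w1 z * deriv w2 z) has_field_derivative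
        (deriv (deriv w1) z * w2 z - w1 z * deriv (deriv w2) z)) (at z)"
      by (auto intro!: derivative_eq_intros d1 d2 that simp: algebra_simps)
    moreover have "((\<lambda>z. 1) has_field_derivative
        (deriv (deriv w1) z * w2 z - w1 z * deriv (deriv w2) z)) (at z) \<longleftrightarrow>
      ((\<lambda>z. deriv w1 z * w2 z - w1 z * deriv w2 z) has_field_derivative
        (deriv (deriv w1) z * w2 z - w1 z * deriv (deriv w2) z)) (at z)"
      using that wronskian
      by (intro DERIV_cong_ev refl eventually_nhds_in_open[of "ball 0 R", THEN eventually_mono]) auto
    ultimately have "((\<lambda>z. 1) has_field_derivative
        (deriv (deriv w1) z * w2 z - w1 z * deriv (deriv w2) z)) (at z)" by simp
    then show ?thesis using DERIV_unique[OF _ DERIV_const] by fastforce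
  qed
  have ode1: "deriv (deriv w1) z = - P z * w1 z" and ode2: "deriv (deriv w2) z = - P z * w2 z"
    if "norm z < R" for z
  proof -
    have "deriv (deriv w1) z = deriv (deriv w1) z * (deriv w1 z * w2 z - w1 z * deriv w2 z)"
      using wronskian[OF that] by simp
    also have "\<dots> = - P z * w1 z"
      using wr'[OF that] unfolding P_def by algebra
    finally show "deriv (deriv w1) z = - P z * w1 z" .
    have "deriv (deriv w2) z = deriv (deriv w2) z * (deriv w1 z * w2 z - w1 z * deriv w2 z)"
      using wronskian[OF that] by simp
    also have "\<dots> = - P z * w2 z"
      using wr'[OF that] unfolding P_def by algebra
    finally show "deriv (deriv w2) z = - P z * w2 z" .
  qed

  define Z where "Z = (\<lambda>t. of_real r * cis t)"
  have nZ: "norm (Z t) = r" "norm (Z t) < R" for t using r by (auto simp: Z_def norm_mult)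
  have ZZ: "Z t * cnj (Z t) = of_real (r\<^sup>2)" for t
    using complex_norm_square[of "Z t"] nZ by simp
  have dZ: "(Z has_vector_derivative (\<i> * Z t)) (at t)" for t
    unfolding Z_def cis_conv_exp
    by (auto intro!: derivative_eq_intros has_vector_derivative_real_field simp: has_real_derivative_iff_has_vector_derivative)
  have along: "((\<lambda>t. g (Z t)) has_vector_derivative (\<i> * Z t * g')) (at t)"
    if "(g has_field_derivative g') (at (Z t))" for g g' t
    using field_vector_diff_chain_at[OF dZ that] by (simp add: o_def)
  define E where "E = (\<lambda>z. z * deriv w1 z * cnj (z * deriv w1 z) + z * deriv w2 z * cnj (z * deriv w2 z))"
  define A where "A = (\<lambda>t. cnj (w1 (Z t)) * (Z t * deriv w1 (Z t)) + cnj (w2 (Z t)) * (Z t * deriv w2 (Z t)))"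
  have N: "w1 (Z t) * cnj (w1 (Z t)) + w2 (Z t) * cnj (w2 (Z t)) = of_real C" for t
    using circle[OF nZ(1), of t] by (simp flip: complex_norm_square of_real_add of_real_power)
  have "C > 0"
  proof -
    have "w1 (Z 0) \<noteq> 0 \<or> w2 (Z 0) \<noteq> 0" using wronskian[OF nZ(2), of 0] by auto
    then show ?thesis using circle[OF nZ(1), of 0] by (auto simp: add_pos_nonneg add_nonneg_pos)
  qed
  have ImA: "Im (A t) = 0" for t
  proof -
    have "((\<lambda>t. w1 (Z t) * cnj (w1 (Z t)) + w2 (Z t) * cnj (w2 (Z t))) has_vector_derivative
       (w1 (Z t) * cnj (\<i> * Z t * deriv w1 (Z t)) + \<i> * Z t * deriv w1 (Z t) * cnj (w1 (Z t))
        + (w2 (Z t) * cnj (\<i> * Z t * deriv w2 (Z t)) + \<i> * Z t * deriv w2 (Z t) * cnj (w2 (Z t))))) (at t)"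
      by (intro has_vector_derivative_add has_vector_derivative_mult has_vector_derivative_cnj along d1 nZ)
    then have "w1 (Z t) * cnj (\<i> * Z t * deriv w1 (Z t)) + \<i> * Z t * deriv w1 (Z t) * cnj (w1 (Z t))
        + (w2 (Z t) * cnj (\<i> * Z t * deriv w2 (Z t)) + \<i> * Z t * deriv w2 (Z t) * cnj (w2 (Z t))) = 0"
      unfolding N using vector_derivative_unique_at has_vector_derivative_const by blast
    then have "\<i> * (A t - cnj (A t)) = 0" by (simp add: A_def algebra_simps)
    then show ?thesis by (simp add: complex_eq_iff)
  qed
  define A' where "A' = (\<lambda>t. \<i> * (A t - E (Z t) - (Z t)\<^sup>2 * P (Z t) * of_real C))"
  have dA: "(A has_vector_derivative A' t) (at t)" for t
  proof -
    have "(A has_vector_derivative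
       (cnj (w1 (Z t)) * (Z t * (\<i> * Z t * deriv (deriv w1) (Z t)) + \<i> * Z t * deriv w1 (Z t))
          + cnj (\<i> * Z t * deriv w1 (Z t)) * (Z t * deriv w1 (Z t))
        + (cnj (w2 (Z t)) * (Z t * (\<i> * Z t * deriv (deriv w2) (Z t)) + \<i> * Z t * deriv w2 (Z t))
          + cnj (\<i> * Z t * deriv w2 (Z t)) * (Z t * deriv w2 (Z t))))) (at t)"
      unfolding A_def
      by (intro has_vector_derivative_add has_vector_derivative_mult has_vector_derivative_cnj along d1 d2 nZ dZ)
    moreover have "cnj (w1 (Z t)) * (Z t * (\<i> * Z t * deriv (deriv w1) (Z t)) + \<i> * Z t * deriv w1 (Z t))
          + cnj (\<i> * Z t * deriv w1 (Z t)) * (Z t * deriv w1 (Z t))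
        + (cnj (w2 (Z t)) * (Z t * (\<i> * Z t * deriv (deriv w2) (Z t)) + \<i> * Z t * deriv w2 (Z t))
          + cnj (\<i> * Z t * deriv w2 (Z t)) * (Z t * deriv w2 (Z t))) = A' t"
      unfolding A'_def A_def E_def N[of t, symmetric] ode1[OF nZ(2)] ode2[OF nZ(2)]
      by (simp add: algebra_simps power2_eq_square)
    ultimately show ?thesis by simp
  qed
  have dRe: "((\<lambda>t. Re (A t)) has_real_derivative Re (A' t)) (at t)" for t
    by (rule has_field_derivative_Re[OF dA])
  have ImA': "Im (A' t) = 0" for t
    using has_field_derivative_Im[OF dA[of t]] DERIV_unique[OF _ DERIV_const] by (fastforce simp: ImA)
  have ACE: "(A t)\<^sup>2 + of_real (r\<^sup>2) = of_real C * E (Z t)" for t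
  proof -
    have wr: "Z t * deriv w1 (Z t) * w2 (Z t) - w1 (Z t) * (Z t * deriv w2 (Z t)) = Z t"
      using arg_cong[OF wronskian[OF nZ(2)[of t]], of "(*) (Z t)"] by (simp add: algebra_simps)
    have "A t * cnj (A t) + Z t * cnj (Z t) = of_real C * E (Z t)"
      using lagrange_identity_complex[of "w1 (Z t)" "Z t * deriv w1 (Z t)" "w2 (Z t)" "Z t * deriv w2 (Z t)"]
      by (simp only: wr A_def E_def N)
    moreover have "cnj (A t) = A t" using ImA[of t] by (simp add: complex_eq_iff)
    ultimately show ?thesis by (simp add: ZZ power2_eq_square)
  qed

  define y where "y = (\<lambda>t. 1 / 2 - Re (A t) / C)"
  have P0: "P z = 0" if "norm z < R" for z
  proof (rule riccati_rigidity[OF P r])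
    show "1 / 4 - r\<^sup>2 / C\<^sup>2 < 1 / 4" using r \<open>C > 0\<close> by simp
    show "(y has_real_derivative (- Re (A' t) / C)) (at t)" for t
      unfolding y_def using DERIV_diff[OF DERIV_const DERIV_cdivide[OF dRe]] by simp
    fix t
    have A: "A t = of_real (Re (A t))" "A' t = of_real (Re (A' t))"
      using ImA[of t] ImA'[of t] by (simp_all add: complex_eq_iff)
    have C: "of_real C \<noteq> (0 :: complex)" using \<open>C > 0\<close> by simp
    have "(Z t)\<^sup>2 * P (Z t) * (of_real C)\<^sup>2 = of_real C * (A t) - of_real C * E (Z t) + \<i> * of_real C * A' t"
      unfolding A'_def by (simp add: algebra_simps power2_eq_square)
    also have "\<dots> = of_real C * A t - ((A t)\<^sup>2 + of_real (r\<^sup>2)) + \<i> * of_real C * A' t"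
      using ACE[of t] by simp
    also have "\<dots> = (of_real ((1 / 4 - r\<^sup>2 / C\<^sup>2) - (y t)\<^sup>2) - \<i> * of_real (- Re (A' t) / C)) * (of_real C)\<^sup>2"
      by (subst A(1), subst A(1), subst A(2)) (use C in \<open>simp add: y_def field_simps power2_eq_square\<close>)
    finally show "(of_real r * cis t)\<^sup>2 * P (of_real r * cis t)
        = of_real ((1 / 4 - r\<^sup>2 / C\<^sup>2) - (y t)\<^sup>2) - \<i> * of_real (- Re (A' t) / C)"
      using C by (simp add: Z_def)
  qed (rule that)
  have affine: "w1 z = w1 0 + deriv w1 0 * z" "w2 z = w2 0 + deriv w2 0 * z" if "norm z < R" for z
    by (rule holomorphic_affine_if_second_deriv_zero[OF _ _ that]; use w ode1 ode2 P0 in simp)+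
  show w1: "w1 z = deriv w1 0 * z" using affine(1)[OF z] \<open>w1 0 = 0\<close> by simp
  have "deriv w2 0 = 0"
  proof (rule constant_norm_on_circle_imp_no_slope[OF _ r(1)])
    show "(norm (deriv w1 0 * z))\<^sup>2 + (norm (w2 0 + deriv w2 0 * z))\<^sup>2 = C" if "norm z = r" for z
      using circle[OF that] affine[of z] that r \<open>w1 0 = 0\<close> by simp
    show "w2 0 \<noteq> 0" using wronskian[of 0] r \<open>w1 0 = 0\<close> by auto
  qed
  then show "w2 z = w2 0" using affine(2)[OF z] by simp
qed


section \<open>Lifting a locally univalent meromorphic function\<close>

lemma locally_univalent_deriv_nonzero:
  assumes "f nicely_meromorphic_on A" "locally_univalent_on f A" "z \<in> A" "\<not> is_pole f z"
  shows "deriv f z \<noteq> 0"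
proof -
  obtain V where V: "open V" "z \<in> V" "f holomorphic_on V"
    using nicely_meromorphic_on_imp_analytic_at[OF assms(1,3,4)] by (auto simp: analytic_at)
  obtain U where U: "open U" "z \<in> U" "inj_on (sphere_map f) U"
    using assms(2,3) by (auto simp: locally_univalent_on_def)
  have "sphere_map f x = Finite (f x)" if "x \<in> V" for x
    using not_is_pole_holomorphic[OF V(1) that V(3)] by (simp add: sphere_map_def)
  then have "inj_on f (U \<inter> V)"
    using U(3) by (auto simp: inj_on_def)
  moreover have "f holomorphic_on U \<inter> V" using V(3) by (rule holomorphic_on_subset) auto
  ultimately show ?thesis
    using holomorphic_injective_imp_regular[of f "U \<inter> V" z] U V by auto
qed

text \<open>
  Near a pole \<open>1 / f\<close> is holomorphic and injective. That \<open>inverse (f z)\<close> itself is holomorphic, without a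
  case distinction at \<open>p\<close>, relies on the conventions \<open>f p = 0\<close> and \<open>inverse 0 = 0\<close>.
\<close>
lemma locally_univalent_pole_is_simple:
  assumes "f nicely_meromorphic_on A" "locally_univalent_on f A" "p \<in> A" "is_pole f p"
  obtains S where "open S" "p \<in> S" "(\<lambda>z. inverse (f z)) holomorphic_on S"
    "\<And>z. z \<in> S - {p} \<Longrightarrow> f z \<noteq> 0 \<and> \<not> is_pole f z"
    "f p = 0" "deriv (\<lambda>z. inverse (f z)) p \<noteq> 0"
proof -
  have mero: "f meromorphic_on A" using assms(1) by (simp add: nicely_meromorphic_on_def)
  have "is_pole f p \<and> f p = 0 \<or> f \<midarrow>p\<rightarrow> f p"
    using assms(1,3) by (auto simp: nicely_meromorphic_on_def)
  then have fp: "f p = 0"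
    using assms(4) not_tendsto_and_filterlim_at_infinity[of "at p" f] by (auto simp: is_pole_def)
  have "isolated_singularity_at f p"
    using meromorphic_on_isolated_singularity[OF meromorphic_on_subset[OF mero]] assms(3) by auto
  then obtain e1 where e1: "e1 > 0" "f analytic_on ball p e1 - {p}"
    by (auto simp: isolated_singularity_at_def)
  obtain e2 where e2: "e2 > 0" "\<And>z. z \<in> ball p e2 - {p} \<Longrightarrow> f z \<noteq> 0"
    using non_zero_neighbour_pole[OF assms(4)] unfolding eventually_at
    by (auto simp: dist_commute)
  obtain U where U: "open U" "p \<in> U" "inj_on (sphere_map f) U"
    using assms(2,3) by (auto simp: locally_univalent_on_def)
  define S where "S = ball p e1 \<inter> ball p e2 \<inter> U"
  have S: "open S" "p \<in> S" using e1 e2 U by (auto simp: S_def)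
  have np: "f z \<noteq> 0 \<and> \<not> is_pole f z" if "z \<in> S - {p}" for z
  proof -
    have "f analytic_on {z}" using e1(2) by (rule analytic_on_subset) (use that in \<open>auto simp: S_def\<close>)
    then show ?thesis using analytic_at_imp_no_pole e2(2) that by (auto simp: S_def)
  qed
  have "f holomorphic_on S - {p}"
    using analytic_imp_holomorphic[OF e1(2)] by (rule holomorphic_on_subset) (auto simp: S_def)
  then have "(\<lambda>z. if z = p then 0 else inverse (f z)) holomorphic_on S"
    using S np assms(4) by (intro is_pole_inverse_holomorphic) auto
  also have "(\<lambda>z. if z = p then 0 else inverse (f z)) = (\<lambda>z. inverse (f z))"
    using fp by auto
  finally have hol: "(\<lambda>z. inverse (f z)) holomorphic_on S" .
  have "inj_on (\<lambda>z. inverse (f z)) S"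
  proof (rule inj_onI)
    fix x y assume xy: "x \<in> S" "y \<in> S" "inverse (f x) = inverse (f y)"
    then have "f x = f y" by simp
    then have "x = p \<longleftrightarrow> y = p" using np fp xy by (metis Diff_iff singletonD)
    then have "sphere_map f x = sphere_map f y"
      using np[of x] np[of y] xy \<open>f x = f y\<close> by (cases "x = p") (auto simp: sphere_map_def)
    then show "x = y" using U(3) xy by (auto simp: S_def inj_on_def)
  qed
  then have "deriv (\<lambda>z. inverse (f z)) p \<noteq> 0"
    using holomorphic_injective_imp_regular[OF hol S(1) _ S(2)] by blast
  with S hol np fp that show thesis by blast
qed

lemma holomorphic_with_simple_zeros:
  fixes K :: "complex set"
  assumes "finite K"
  obtains h where "h holomorphic_on UNIV" "\<And>z. h z = 0 \<longleftrightarrow> z \<in> K" "\<And>z. z \<in> K \<Longrightarrow> deriv h z \<noteq> 0"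
proof
  define h where "h = (\<lambda>z. \<Prod>p\<in>K. z - p)"
  show "h holomorphic_on UNIV" unfolding h_def by (intro holomorphic_intros)
  show "h z = 0 \<longleftrightarrow> z \<in> K" for z using assms by (auto simp: h_def)
  fix p assume p: "p \<in> K"
  define k where "k = (\<lambda>z. \<Prod>q\<in>K - {p}. z - q)"
  have "k holomorphic_on UNIV" unfolding k_def by (intro holomorphic_intros)
  then have "(k has_field_derivative deriv k p) (at p)" by (rule holomorphic_derivI) auto
  then have "((\<lambda>z. (z - p) * k z) has_field_derivative k p) (at p)"
    by (auto intro!: derivative_eq_intros)
  moreover have "h = (\<lambda>z. (z - p) * k z)"
    unfolding h_def k_def using prod.remove[OF assms p] by auto
  ultimately have "deriv h p = k p" using DERIV_imp_deriv by blast
  then show "deriv h p \<noteq> 0" using assms by (auto simp: k_def)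
qed


text \<open>
  Clear the finitely many poles: with \<open>h\<close> vanishing simply at the poles, \<open>g = f h\<close> is holomorphic. The
  Wronskian of \<open>g\<close> and \<open>h\<close> is \<open>f' h\<^sup>2\<close> away from the poles, and equals \<open>- g h'\<close> at a pole. Local
  univalence makes it zero-free, so it has a holomorphic square root \<open>s\<close>; dividing \<open>g\<close> and \<open>h\<close> by \<open>s\<close>
  normalizes the Wronskian to one. The equation \<open>f z = w1 z / w2 z\<close> also holds at poles, where both sides
  are zero by convention.
\<close>
lemma spherical_lift:
  assumes f: "f nicely_meromorphic_on A" "locally_univalent_on f A" and A: "open A" "cball 0 R \<subseteq> A"
  obtains w1 w2 where "w1 holomorphic_on ball 0 R" "w2 holomorphic_on ball 0 R"
    "\<And>z. norm z < R \<Longrightarrow> deriv w1 z * w2 z - w1 z * deriv w2 z = 1"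
    "\<And>z. norm z < R \<Longrightarrow> is_pole f z \<longleftrightarrow> w2 z = 0"
    "\<And>z. norm z < R \<Longrightarrow> f z = w1 z / w2 z"
proof -
  define K where "K = cball 0 R \<inter> {z. is_pole f z}"
  have K: "p \<in> A" "is_pole f p" if "p \<in> K" for p using that A by (auto simp: K_def)
  have "\<not> z islimpt {z. is_pole f z}" if "z \<in> A" for z
  proof (rule not_islimpt_poles[OF meromorphic_on_isolated_singularity])
    show "f meromorphic_on {z}"
      using f(1) that by (auto simp: nicely_meromorphic_on_def intro: meromorphic_on_subset)
  qed
  then have "{z. is_pole f z} sparse_in A"
    using A(1) by (simp add: sparse_in_open)
  then have finK: "finite K"
    unfolding K_def using sparse_in_compact_finite[OF sparse_in_subset[OF _ A(2)]] by auto
  obtain h where h: "h holomorphic_on UNIV" and hK: "\<And>z. h z = 0 \<longleftrightarrow> z \<in> K"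
      and h': "\<And>z. z \<in> K \<Longrightarrow> deriv h z \<noteq> 0"
    by (rule holomorphic_with_simple_zeros[OF finK]) (rule that; assumption)
  have dh: "(h has_field_derivative deriv h z) (at z)" for z
    using h by (rule holomorphic_derivI) auto
  define g where "g = (\<lambda>z. if z \<in> K then deriv h z / deriv (\<lambda>z. inverse (f z)) z else f z * h z)"
  let ?B = "ball (0::complex) R"
  have hB: "h holomorphic_on ?B" using h by (rule holomorphic_on_subset) auto
  have openBK: "open (?B - K)" using finK by (intro open_Diff finite_imp_closed) auto
  have fBK: "f holomorphic_on ?B - K"
  proof (rule analytic_imp_holomorphic)
    have "f analytic_on {z}" if "z \<in> ?B - K" for z
      using that A(2) by (intro nicely_meromorphic_on_imp_analytic_at[OF f(1)]) (auto simp: K_def)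
    then show "f analytic_on ?B - K" using analytic_on_analytic_at by blast
  qed
  have g: "g holomorphic_on ?B"
  proof (rule no_isolated_singularity'[OF _ _ open_ball finK])
    have "(\<lambda>z. f z * h z) holomorphic_on ?B - K"
      by (intro holomorphic_intros fBK holomorphic_on_subset[OF hB]) auto
    then show "g holomorphic_on ?B - K"
      by (rule holomorphic_transform) (auto simp: g_def)
  next
    fix p assume p: "p \<in> K"
    obtain S where S: "open S" "p \<in> S" "(\<lambda>z. inverse (f z)) holomorphic_on S"
      "\<And>z. z \<in> S - {p} \<Longrightarrow> f z \<noteq> 0 \<and> \<not> is_pole f z"
      "f p = 0" "deriv (\<lambda>z. inverse (f z)) p \<noteq> 0"
      by (rule locally_univalent_pole_is_simple[OF f K[OF p]]) (rule that; assumption)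
    \<comment> \<open>Near \<open>p\<close>, \<open>g\<close> is the quotient of \<open>h\<close> and \<open>1 / f\<close>, which both vanish at \<open>p\<close>, so it tends to the
      quotient of their derivatives.\<close>
    have "((\<lambda>z. ((h z - h p) / (z - p)) / ((inverse (f z) - inverse (f p)) / (z - p))) \<longlongrightarrow>
        deriv h p / deriv (\<lambda>z. inverse (f z)) p) (at p)"
      by (intro tendsto_divide S(6))
         (use dh[of p] holomorphic_derivI[OF S(3,1,2)] in \<open>auto simp: has_field_derivative_iff\<close>)
    moreover have "eventually (\<lambda>z. ((h z - h p) / (z - p)) / ((inverse (f z) - inverse (f p)) / (z - p)) = g z) (at p)"
      using eventually_at_in_open[OF S(1,2)]
    proof eventually_elim
      case (elim z)
      then have "z \<notin> K" using S(4) K(2) by blast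
      moreover have "h p = 0" using hK p by simp
      ultimately show ?case using elim S(5) by (simp add: g_def field_simps)
    qed
    ultimately have "(g \<longlongrightarrow> g p) (at p)"
      using p by (simp add: g_def tendsto_cong)
    then show "(g \<longlongrightarrow> g p) (at p within ?B)" by (rule tendsto_within_subset) auto
  qed
  define W where "W = (\<lambda>z. deriv g z * h z - g z * deriv h z)"
  have W_hol: "W holomorphic_on ?B"
    unfolding W_def by (intro holomorphic_intros holomorphic_deriv g hB open_ball)
  have W_nz: "W z \<noteq> 0" if z: "z \<in> ?B" for z
  proof (cases "z \<in> K")
    case True
    have "deriv (\<lambda>z. inverse (f z)) z \<noteq> 0"
      by (rule locally_univalent_pole_is_simple[OF f K[OF True]])
    then show ?thesis using True hK[of z] h' by (simp add: W_def g_def)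
  next
    case False
    have "(f has_field_derivative deriv f z) (at z)"
      using fBK openBK by (rule holomorphic_derivI) (use False z in auto)
    then have "((\<lambda>z. f z * h z) has_field_derivative (deriv f z * h z + deriv h z * f z)) (at z)"
      by (intro DERIV_mult dh)
    moreover have "eventually (\<lambda>x. f x * h x = g x) (nhds z)"
      using eventually_nhds_in_open[OF openBK, of z] False z by (auto simp: g_def elim!: eventually_mono)
    ultimately have "(g has_field_derivative (deriv f z * h z + deriv h z * f z)) (at z)"
      by (rule DERIV_cong_ev[OF refl _ refl, THEN iffD1, rotated])
    then have "deriv g z = deriv f z * h z + deriv h z * f z" by (rule DERIV_imp_deriv)
    then have "W z = deriv f z * (h z)\<^sup>2"
      using False by (simp add: W_def g_def power2_eq_square algebra_simps)
    moreover have "deriv f z \<noteq> 0"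
      using False z A(2) by (intro locally_univalent_deriv_nonzero[OF f]) (auto simp: K_def)
    ultimately show ?thesis using False hK by simp
  qed
  obtain s where s: "s holomorphic_on ?B" "\<And>z. z \<in> ?B \<Longrightarrow> W z = (s z)\<^sup>2"
    by (rule contractible_imp_holomorphic_sqrt[OF W_hol convex_imp_contractible[OF convex_ball] W_nz])
       (assumption, (rule that; assumption))
  have s_nz: "s z \<noteq> 0" if "z \<in> ?B" for z
    using W_nz[OF that] s(2)[OF that] by auto
  show thesis
  proof (rule that)
    show "(\<lambda>z. g z / s z) holomorphic_on ?B" "(\<lambda>z. h z / s z) holomorphic_on ?B"
      using s_nz by (auto intro!: holomorphic_intros g hB s)
    fix z :: complex assume z: "norm z < R"
    then have zB: "z \<in> ?B" by simp
    have ds: "(s has_field_derivative deriv s z) (at z)" and dg: "(g has_field_derivative deriv g z) (at z)"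
      using zB s(1) g by (auto intro: holomorphic_derivI)
    have dq: "deriv (\<lambda>z. g z / s z) z = (deriv g z * s z - g z * deriv s z) / (s z * s z)"
      "deriv (\<lambda>z. h z / s z) z = (deriv h z * s z - h z * deriv s z) / (s z * s z)"
      by (intro DERIV_imp_deriv DERIV_divide dg ds dh s_nz zB)+
    have "deriv (\<lambda>z. g z / s z) z * (h z / s z) - g z / s z * deriv (\<lambda>z. h z / s z) z = W z / (s z)\<^sup>2"
      using s_nz[OF zB] unfolding dq W_def
      by (simp add: field_simps power2_eq_square)
    then show "deriv (\<lambda>z. g z / s z) z * (h z / s z) - g z / s z * deriv (\<lambda>z. h z / s z) z = 1"
      using s(2)[OF zB] s_nz[OF zB] by simp
    have pole: "is_pole f z \<longleftrightarrow> z \<in> K" using z by (simp add: K_def)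
    then show "is_pole f z \<longleftrightarrow> h z / s z = 0" using hK s_nz[OF zB] by simp
    show "f z = (g z / s z) / (h z / s z)"
    proof (cases "z \<in> K")
      case True
      have "f z = 0" by (rule locally_univalent_pole_is_simple[OF f K[OF True]])
      then show ?thesis using True hK by simp
    next
      case False
      then show ?thesis using hK[of z] s_nz[OF zB] by (simp add: g_def)
    qed
  qed
qed


text \<open>
  The derivative of \<open>w1 / w2\<close> is \<open>1 / w2\<^sup>2\<close>, and that of \<open>w2 / w1\<close> is \<open>- 1 / w1\<^sup>2\<close>. This gives one formula that is
  valid at poles and elsewhere.
\<close>
lemma spherical_derivative_lift:
  assumes w: "w1 holomorphic_on ball 0 R" "w2 holomorphic_on ball 0 R"
    and wronskian: "\<And>z. norm z < R \<Longrightarrow> deriv w1 z * w2 z - w1 z * deriv w2 z = 1"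
    and pole: "\<And>z. norm z < R \<Longrightarrow> is_pole f z \<longleftrightarrow> w2 z = 0"
    and quot: "\<And>z. norm z < R \<Longrightarrow> f z = w1 z / w2 z"
    and z: "norm z < R"
  shows "spherical_derivative f z = 1 / ((norm (w1 z))\<^sup>2 + (norm (w2 z))\<^sup>2)"
proof -
  have zB: "z \<in> ball 0 R" using z by simp
  have d: "(w1 has_field_derivative deriv w1 z) (at z)" "(w2 has_field_derivative deriv w2 z) (at z)"
    by (rule holomorphic_derivI[OF w(1) open_ball zB] holomorphic_derivI[OF w(2) open_ball zB])+
  have near: "eventually (\<lambda>x. f x = w1 x / w2 x) (nhds z)"
    using eventually_nhds_in_open[OF open_ball zB] by eventually_elim (simp add: quot)
  show ?thesis
  proof (cases "w2 z = 0")
    case True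
    then have w1: "w1 z * deriv w2 z = - 1" using wronskian[OF z] by (simp add: algebra_simps minus_equation_iff)
    then have w1z: "w1 z \<noteq> 0" by auto
    have "((\<lambda>x. w2 x / w1 x) has_field_derivative (deriv w2 z * w1 z - w2 z * deriv w1 z) / (w1 z * w1 z)) (at z)"
      by (intro DERIV_divide d w1z)
    moreover have "eventually (\<lambda>x. w2 x / w1 x = inverse (f x)) (nhds z)"
      using near by eventually_elim simp
    ultimately have "((\<lambda>x. inverse (f x)) has_field_derivative (deriv w2 z * w1 z - w2 z * deriv w1 z) / (w1 z * w1 z)) (at z)"
      by (rule DERIV_cong_ev[OF refl _ refl, THEN iffD1, rotated])
    then have "deriv (\<lambda>x. inverse (f x)) z = - 1 / (w1 z * w1 z)"
      using True w1 by (simp add: DERIV_imp_deriv mult.commute)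
    then show ?thesis
      using True pole[OF z] by (simp add: spherical_derivative_def norm_divide norm_mult power2_eq_square)
  next
    case False
    have "((\<lambda>x. w1 x / w2 x) has_field_derivative (deriv w1 z * w2 z - w1 z * deriv w2 z) / (w2 z * w2 z)) (at z)"
      by (intro DERIV_divide d False)
    then have "(f has_field_derivative (deriv w1 z * w2 z - w1 z * deriv w2 z) / (w2 z * w2 z)) (at z)"
      by (rule DERIV_cong_ev[OF refl near refl, THEN iffD2])
    then have "deriv f z = 1 / (w2 z * w2 z)"
      using wronskian[OF z] by (simp add: DERIV_imp_deriv)
    moreover have "(norm (w2 z))\<^sup>2 > 0" using False by simp
    ultimately show ?thesis
      using False pole[OF z] quot[OF z]
      by (simp add: spherical_derivative_def norm_divide norm_mult power_divide)
         (simp add: divide_simps power2_eq_square add_pos_nonneg add_nonneg_pos add_nonneg_eq_0_iff)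
  qed
qed

section \<open>From arc lengths to densities\<close>

lemma conformal_length_part_circlepath:
  assumes "0 \<le> r" "a \<le> b"
  shows "conformal_length \<sigma> (part_circlepath 0 r a b)
    = r * (b - a) * integral {0..1} (\<lambda>t. \<sigma> (of_real r * cis (linepath a b t)))"
proof -
  have "conformal_length \<sigma> (part_circlepath 0 r a b)
      = integral {0..1} (\<lambda>t. r * (b - a) * \<sigma> (of_real r * cis (linepath a b t)))"
    unfolding conformal_length_def
  proof (rule integral_cong)
    fix t :: real assume t: "t \<in> {0..1}"
    have "norm (vector_derivative (part_circlepath 0 r a b) (at t within {0..1})) = r * (b - a)"
      using t assms
      by (subst vector_derivative_part_circlepath01)
         (auto simp: norm_mult cis_conv_exp[symmetric] simp flip: of_real_diff)
    then show "\<sigma> (part_circlepath 0 r a b t) * norm (vector_derivative (part_circlepath 0 r a b) (at t within {0..1}))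
       = r * (b - a) * \<sigma> (of_real r * cis (linepath a b t))"
      by (simp add: part_circlepath_def cis_conv_exp)
  qed
  then show ?thesis by simp
qed

text \<open>
  If the densities differ at a point of the circle, then by continuity their difference has a constant
  sign on a short arc starting there, and the two lengths of this arc cannot agree.
\<close>
lemma equal_arc_lengths_imp_equal_densities:
  assumes cont: "continuous_on (sphere 0 r) \<sigma>" "continuous_on (sphere 0 r) \<tau>" and r: "0 < r"
    and len: "\<And>a b. a < b \<Longrightarrow> b \<le> a + 2 * pi \<Longrightarrow>
      conformal_length \<sigma> (part_circlepath 0 r a b) = conformal_length \<tau> (part_circlepath 0 r a b)"
    and z: "norm z = r"
  shows "\<sigma> z = \<tau> z"
proof (rule ccontr)
  assume neq: "\<sigma> z \<noteq> \<tau> z"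
  define \<delta> where "\<delta> = (\<lambda>t. \<sigma> (of_real r * cis t) - \<tau> (of_real r * cis t))"
  have cs: "continuous_on UNIV (\<lambda>t. \<sigma> (of_real r * cis t))" "continuous_on UNIV (\<lambda>t. \<tau> (of_real r * cis t))"
    by (rule continuous_on_compose2[OF cont(1)] continuous_on_compose2[OF cont(2)];
        use r in \<open>auto intro!: continuous_intros simp: norm_mult\<close>)+
  then have c\<delta>: "continuous_on UNIV \<delta>" unfolding \<delta>_def by (intro continuous_intros)
  define t0 where "t0 = Arg z"
  have "of_real r * cis t0 = z" using rcis_cmod_Arg[of z] z by (simp add: t0_def rcis_def)
  with neq have t0: "\<delta> t0 \<noteq> 0" by (simp add: \<delta>_def)
  have "isCont \<delta> t0" using c\<delta> by (simp add: continuous_on_eq_continuous_at)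
  then obtain e where e: "e > 0" "\<And>t. \<bar>t - t0\<bar> < e \<Longrightarrow> \<bar>\<delta> t - \<delta> t0\<bar> < \<bar>\<delta> t0\<bar>"
    using t0 unfolding continuous_at_eps_delta by (metis dist_real_def zero_less_abs_iff)
  \<comment> \<open>The arc stays where the sign of \<open>\<delta>\<close> is known, and covers at most half a turn.\<close>
  define b where "b = t0 + min (e / 2) pi"
  have b: "t0 < b" "b \<le> t0 + 2 * pi" "b - t0 < e" using e(1) min.cobounded1[of "e / 2" pi] min.cobounded2[of "e / 2" pi] pi_gt_zero
    unfolding b_def by (simp, linarith, linarith)
  have cl: "continuous_on {0..1} (\<lambda>t. g (linepath t0 b t))" if "continuous_on UNIV g" for g :: "real \<Rightarrow> real"
    by (rule continuous_on_compose2[OF that]) (auto intro!: continuous_intros)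
  have "integral {0..1} (\<lambda>t. \<sigma> (of_real r * cis (linepath t0 b t))) = integral {0..1} (\<lambda>t. \<tau> (of_real r * cis (linepath t0 b t)))"
    using len[OF b(1,2)] b(1) r by (simp add: conformal_length_part_circlepath)
  then have "integral {0..1} (\<lambda>t. \<delta> (linepath t0 b t)) = 0"
    unfolding \<delta>_def by (subst integral_diff) (auto intro!: integrable_continuous_interval cl cs)
  then have int0: "integral {0..1} (\<lambda>t. \<delta> t0 * \<delta> (linepath t0 b t)) = 0" by simp
  have pos: "\<delta> t0 * \<delta> (linepath t0 b t) > 0" if t: "t \<in> {0..1}" for t
  proof -
    have "linepath t0 b t - t0 = t * (b - t0)" by (simp add: linepath_def algebra_simps)
    moreover have "0 \<le> t * (b - t0)" using t b(1) by simp
    moreover have "t * (b - t0) < e"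
      by (rule le_less_trans[OF mult_left_le_one_le b(3)]) (use t b(1) in auto)
    ultimately have "\<bar>linepath t0 b t - t0\<bar> < e" by simp
    from e(2)[OF this] show ?thesis
      by (cases "\<delta> t0 > 0") (auto simp: abs_if zero_less_mult_iff split: if_splits)
  qed
  have "\<forall>t\<in>{0..1}. \<delta> t0 * \<delta> (linepath t0 b t) = 0"
    using int0 pos by (subst (asm) integral_eq_0_iff) (auto intro!: continuous_intros cl c\<delta> less_imp_le)
  with pos[of 0] show False by auto
qed

section \<open>Length-preserving maps\<close>

theorem corollary1p5:
  fixes f :: "complex \<Rightarrow> complex" and \<rho> :: real
  assumes "f nicely_meromorphic_on ball 0 1"
    and "locally_univalent_on f (ball 0 1)"
    and "sphere_map f 0 = Finite 0"
    and "0 < \<rho>" and "\<rho> < 1"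
    and "length_preserving_on_circle f \<rho>"
  shows "\<exists>\<eta>::complex. \<forall>z\<in>ball 0 1. sphere_map f z = Finite (\<eta> * z)"
proof (intro exI[of _ "deriv f 0"] ballI)
  fix z :: complex assume z: "z \<in> ball 0 1"
  then obtain R where R: "max \<rho> (norm z) < R" "R < 1"
    using dense[of "max \<rho> (norm z)" 1] assms(5) by auto
  have sub: "cball 0 R \<subseteq> ball (0::complex) 1" using R by auto
  obtain w1 w2 where w: "w1 holomorphic_on ball 0 R" "w2 holomorphic_on ball 0 R"
    and wronskian: "\<And>z. norm z < R \<Longrightarrow> deriv w1 z * w2 z - w1 z * deriv w2 z = 1"
    and pole: "\<And>z. norm z < R \<Longrightarrow> is_pole f z \<longleftrightarrow> w2 z = 0"
    and quot: "\<And>z. norm z < R \<Longrightarrow> f z = w1 z / w2 z"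
    by (rule spherical_lift[OF assms(1,2) open_ball sub]) (rule that; assumption)
  have sd: "spherical_derivative f z = 1 / ((norm (w1 z))\<^sup>2 + (norm (w2 z))\<^sup>2)" if "norm z < R" for z
    by (rule spherical_derivative_lift[OF w wronskian pole quot that])
  have R0: "norm (0::complex) < R" using R assms(4) by simp
  have f0: "\<not> is_pole f 0" "f 0 = 0" using assms(3) by (auto simp: sphere_map_def split: if_splits)
  have w20: "w2 0 \<noteq> 0" using pole[OF R0] f0(1) by blast
  then have w10: "w1 0 = 0" using quot[OF R0] f0(2) by simp
  have nz: "(norm (w1 x))\<^sup>2 + (norm (w2 x))\<^sup>2 \<noteq> 0" if "norm x < R" for x
    using wronskian[OF that] by (auto simp: add_nonneg_eq_0_iff)
  have density: "spherical_derivative f x = hyperbolic_density x" if "norm x = \<rho>" for x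
  proof (rule equal_arc_lengths_imp_equal_densities[OF _ _ assms(4) _ that])
    have sub': "sphere 0 \<rho> \<subseteq> ball (0::complex) R" using R by auto
    have cw: "continuous_on (sphere 0 \<rho>) w1" "continuous_on (sphere 0 \<rho>) w2"
      using w[THEN holomorphic_on_imp_continuous_on, THEN continuous_on_subset, OF sub'] by auto
    have "continuous_on (sphere 0 \<rho>) (\<lambda>x. 1 / ((norm (w1 x))\<^sup>2 + (norm (w2 x))\<^sup>2))"
      using nz sub' by (intro continuous_intros cw) auto
    then show "continuous_on (sphere 0 \<rho>) (spherical_derivative f)"
      using sd sub' by (subst continuous_on_cong[OF refl]) auto
    show "continuous_on (sphere 0 \<rho>) hyperbolic_density"
      unfolding hyperbolic_density_def
      using assms(4,5) by (auto intro!: continuous_intros simp: power2_eq_1_iff)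
  qed (use assms(6) in \<open>auto simp: length_preserving_on_circle_def spherical_image_length_def hyperbolic_length_def\<close>)
  have circle: "(norm (w1 x))\<^sup>2 + (norm (w2 x))\<^sup>2 = 1 - \<rho>\<^sup>2" if "norm x = \<rho>" for x
    using density[OF that] sd[of x] that R by (simp add: hyperbolic_density_def)
  have lin: "w1 x = deriv w1 0 * x" "w2 x = w2 0" if "norm x < R" for x
    using normalized_pair_rigidity[OF w assms(4) _ wronskian circle w10 that] R by auto
  have fx: "f x = deriv w1 0 / w2 0 * x" if "norm x < R" for x
    using quot[OF that] lin[OF that] by simp
  have "(f has_field_derivative deriv w1 0 / w2 0) (at 0)"
  proof (rule has_field_derivative_transform_within_open[OF _ open_ball[of 0 R]])
    show "((\<lambda>x. deriv w1 0 / w2 0 * x) has_field_derivative deriv w1 0 / w2 0) (at 0)"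
      by (rule DERIV_cmult_Id)
  qed (use R0 fx in auto)
  then have "deriv f 0 = deriv w1 0 / w2 0" by (rule DERIV_imp_deriv)
  moreover have "norm z < R" using R by simp
  ultimately show "sphere_map f z = Finite (deriv f 0 * z)"
    using fx[of z] pole[of z] lin(2)[of z] w20 by (simp add: sphere_map_def)
qed

end
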